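(* For every positive integer $n$ there is a permutation of length $22n^{3/2}+\Theta(n)$ that contains every $321$-avoiding permutation of length $n$ as a pattern (an $S_n(321)$-superpattern).
   Context: A permutation $\pi$ of length $k$ is a pattern of a permutation $\sigma$ if there are indices $\ell_1<\cdots<\ell_k$ with $\pi_i<\pi_j$ iff $\sigma_{\ell_i}<\sigma_{\ell_j}$. $S_n(321)$ denotes the set of permutations of $\{1,\dots,n\}$ that do not contain $321$ as a pattern. A $P$-superpattern is a permutation containing every permutation of the set $P$ as a pattern. *)

theory Defs
  imports Complex_Main "HOL-Library.Landau_Symbols"
begin

definition is_perm :: "nat \<Rightarrow> nat list \<Rightarrow> bool" where
  "is_perm n xs \<longleftrightarrow> length xs = n \<and> distinct xs \<and> set xs = {1..n}"

definition contains_pattern :: "nat list \<Rightarrow> nat list \<Rightarrow> bool" where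
  "contains_pattern \<sigma> \<pi> \<longleftrightarrow>
     (\<exists>l :: nat \<Rightarrow> nat.
        (\<forall>i j. i < j \<and> j < length \<pi> \<longrightarrow> l i < l j) \<and>
        (\<forall>i < length \<pi>. l i < length \<sigma>) \<and>
        (\<forall>i < length \<pi>. \<forall>j < length \<pi>. (\<pi> ! i < \<pi> ! j) \<longleftrightarrow> (\<sigma> ! l i < \<sigma> ! l j)))"

definition S321 :: "nat \<Rightarrow> nat list set" where
  "S321 n = {\<pi>. is_perm n \<pi> \<and> \<not> contains_pattern \<pi> [3, 2, 1]}"

definition superpattern :: "nat list set \<Rightarrow> nat list \<Rightarrow> bool" where
  "superpattern P \<sigma> \<longleftrightarrow> (\<forall>\<pi> \<in> P. contains_pattern \<sigma> \<pi>)"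

end

theory Submission
  imports Defs "HOL-Library.Product_Lexorder"
begin

text \<open>
  A 321-avoiding permutation can be drawn on two parallel lines: there are reals \<open>s\<close>, increasing in
  the position, such that the values are ordered like \<open>s + 1\<close> on the left-to-right maxima and like
  \<open>s\<close> on the other entries. The integer part of \<open>s\<close> names a column of a staircase of cells, and
  within a column and the two rows meeting it only the fractional part matters.

  Let \<open>k\<close> be about the square root of \<open>n\<close> and count the entries by increasing \<open>s\<close>. An integer is
  heavy if a multiple of \<open>k\<close> is passed while counting the entries with that integer part. There are
  at most \<open>n / k\<close> heavy integers, and at most \<open>k\<close> entries lie between two consecutive ones. These
  light runs fit into a \<open>k\<close> by \<open>k\<close> grid. The entries of a heavy column can be put on the
  diagonal of their cells, since its column and rows may share one clock. A clock of length
  \<open>n + 2 * k\<^sup>2\<close> leaves room to delay it, at each of the at most \<open>2 * k\<close> adjacent light entries, until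
  it shows a prescribed residue modulo \<open>k\<close>; so the cells joining light columns to heavy rows
  need only one point per tick. In total this takes about \<open>n / k * (5 * n + 11 * k\<^sup>2)\<close> points,
  that is \<open>16 * n powr (3/2)\<close> up to a linear term.
\<close>

section \<open>Drawing a 321-avoiding permutation on two parallel lines\<close>

lemma exists_strictly_between:
  fixes A B :: "real set"
  assumes "finite A" "finite B" "A \<noteq> {}" "\<And>a b. a \<in> A \<Longrightarrow> b \<in> B \<Longrightarrow> a < b"
  shows "\<exists>v. (\<forall>a\<in>A. a < v) \<and> (\<forall>b\<in>B. v < b)"
proof (cases "B = {}")
  case True
  have "\<forall>a\<in>A. a < Max A + 1"
    using assms(1) by (meson Max_ge less_add_one order_le_less_trans)
  with True show ?thesis by blast
next
  case False
  have "Max A < Min B" using assms False by simp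
  then obtain v where "Max A < v" "v < Min B" using dense by blast
  then show ?thesis using assms False by auto
qed

lemma S321_no_decreasing_triple:
  assumes "\<pi> \<in> S321 n" "i < j" "j < l" "l < n" "\<pi> ! j < \<pi> ! i" "\<pi> ! l < \<pi> ! j"
  shows False
proof -
  have len: "length \<pi> = n" using assms(1) by (auto simp: S321_def is_perm_def)
  have "contains_pattern \<pi> [3, 2, 1]"
    unfolding contains_pattern_def
  proof (intro exI[of _ "\<lambda>x. if x = 0 then i else if x = 1 then j else l"] conjI)
    show "\<forall>x<length [3, 2, 1::nat]. \<forall>y<length [3, 2, 1::nat].
        ([3, 2, 1] ! x < ([3, 2, 1] ! y :: nat)) =
        (\<pi> ! (if x = 0 then i else if x = 1 then j else l)
         < \<pi> ! (if y = 0 then i else if y = 1 then j else l))"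
      using assms by (auto simp: less_Suc_eq numeral_3_eq_3)
  qed (use assms len in \<open>auto simp: less_Suc_eq\<close>)
  then show False using assms(1) by (auto simp: S321_def)
qed

definition nonrecord :: "nat list \<Rightarrow> nat \<Rightarrow> bool" where
  "nonrecord \<pi> p \<longleftrightarrow> (\<exists>q<p. \<pi> ! p < \<pi> ! q)"

abbreviation lift :: "nat list \<Rightarrow> nat \<Rightarrow> real" where
  "lift \<pi> p \<equiv> of_bool (\<not> nonrecord \<pi> p)"

text \<open>
  The last conjunct is the invariant that keeps the induction going: as long as a record
  still has to be undercut later on, no abscissa may move a full unit past it.
\<close>
lemma parallel_lines_prefix:
  assumes \<pi>: "\<pi> \<in> S321 n" and "m \<le> n"
  shows "\<exists>s :: nat \<Rightarrow> real. (\<forall>p<m. 1 < s p) \<and> (\<forall>q<m. \<forall>p<q. s p < s q) \<and>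
     (\<forall>p<m. \<forall>q<m. \<pi> ! p < \<pi> ! q \<longrightarrow> s p + lift \<pi> p < s q + lift \<pi> q) \<and>
     (\<forall>p<m. \<not> nonrecord \<pi> p \<and> (\<exists>q\<ge>m. q < n \<and> \<pi> ! q < \<pi> ! p) \<longrightarrow> (\<forall>r<m. s r < s p + 1))"
  using \<open>m \<le> n\<close>
proof (induction m)
  case 0
  then show ?case by simp
next
  case (Suc m)
  from Suc.IH[OF Suc_leD[OF Suc.prems]] obtain s :: "nat \<Rightarrow> real" where
    s: "\<forall>p<m. 1 < s p" "\<forall>q<m. \<forall>p<q. s p < s q"
      "\<forall>p<m. \<forall>q<m. \<pi> ! p < \<pi> ! q \<longrightarrow> s p + lift \<pi> p < s q + lift \<pi> q"
      "\<forall>p<m. \<not> nonrecord \<pi> p \<and> (\<exists>q\<ge>m. q < n \<and> \<pi> ! q < \<pi> ! p) \<longrightarrow> (\<forall>r<m. s r < s p + 1)"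
    by (elim exE conjE)
  have gt1: "\<And>p. p < m \<Longrightarrow> 1 < s p" and
    inc: "\<And>p q. q < m \<Longrightarrow> p < q \<Longrightarrow> s p < s q" and
    ord: "\<And>p q. p < m \<Longrightarrow> q < m \<Longrightarrow> \<pi> ! p < \<pi> ! q \<Longrightarrow> s p + lift \<pi> p < s q + lift \<pi> q" and
    inv: "\<And>p q r. p < m \<Longrightarrow> \<not> nonrecord \<pi> p \<Longrightarrow> m \<le> q \<Longrightarrow> q < n \<Longrightarrow> \<pi> ! q < \<pi> ! p \<Longrightarrow>
            r < m \<Longrightarrow> s r < s p + 1"
    using s by simp_all blast
  have "m < n" using Suc.prems by simp
  have dist: "p = q" if "p < n" "q < n" "\<pi> ! p = \<pi> ! q" for p q
    using \<pi> that by (auto simp: S321_def is_perm_def nth_eq_iff_index_eq)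
  \<comment> \<open>A smaller later entry would complete a 321 with \<open>p\<close> and the larger
    entry before \<open>p\<close>.\<close>
  have low: "\<pi> ! p < \<pi> ! q" if "nonrecord \<pi> p" "p < q" "q < n" for p q
  proof (rule ccontr)
    assume "\<not> \<pi> ! p < \<pi> ! q"
    then have "\<pi> ! q < \<pi> ! p" using dist[of p q] that by force
    with that S321_no_decreasing_triple[OF \<pi>] show False by (auto simp: nonrecord_def)
  qed
  have up: "\<pi> ! q < \<pi> ! p" if "\<not> nonrecord \<pi> p" "q < p" "p < n" for p q
    using that dist[of p q] by (force simp: nonrecord_def)
  \<comment> \<open>The new abscissa must exceed \<open>A\<close>: 1, the earlier abscissae and, for
    a nonrecord, the heights of smaller records. It must stay below \<open>B\<close>: the heights of
    records undercut at \<open>m\<close> (for the order of heights) or later (for the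
    invariant).\<close>
  define A where "A = insert 1 (s ` {..<m} \<union>
    {s p + 1 | p. p < m \<and> nonrecord \<pi> m \<and> \<not> nonrecord \<pi> p \<and> \<pi> ! p < \<pi> ! m})"
  define B where "B = {s p + 1 | p. p < m \<and> \<not> nonrecord \<pi> p \<and> (\<exists>q\<ge>m. q < n \<and> \<pi> ! q < \<pi> ! p)}"
  have "\<exists>v. (\<forall>a\<in>A. a < v) \<and> (\<forall>b\<in>B. v < b)"
  proof (rule exists_strictly_between)
    fix a b assume "a \<in> A" "b \<in> B"
    from \<open>b \<in> B\<close> obtain p q where p: "b = s p + 1" "p < m" "\<not> nonrecord \<pi> p" "q \<ge> m" "q < n"
      "\<pi> ! q < \<pi> ! p" by (auto simp: B_def)
    from \<open>a \<in> A\<close> consider "a = 1" | r where "a = s r" "r < m"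
      | r where "a = s r + 1" "r < m" "nonrecord \<pi> m" "\<not> nonrecord \<pi> r" "\<pi> ! r < \<pi> ! m"
      unfolding A_def by auto
    then show "a < b"
    proof cases
      case 1
      then show ?thesis using gt1[of p] p by simp
    next
      case 2
      then show ?thesis using inv p by blast
    next
      case 3
      \<comment> \<open>Since \<open>m\<close> is a nonrecord, \<open>low\<close> puts its value at
        or below that of \<open>q\<close>, hence below that of \<open>p\<close>. So record
        \<open>r\<close> is smaller than record \<open>p\<close>, and records increase.\<close>
      have "\<pi> ! m \<le> \<pi> ! q" using low[of m q] 3 p by (cases "q = m") auto
      then have "\<pi> ! r < \<pi> ! p" using 3 p by simp
      moreover have "\<pi> ! p < \<pi> ! r" if "p < r" using up[of r p] that 3 \<open>m < n\<close> by simp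
      ultimately have "r < p" by (metis less_asym linorder_neqE_nat)
      then show ?thesis using inc p 3 by simp
    qed
  qed (auto simp: A_def B_def)
  then obtain v where vA: "\<And>a. a \<in> A \<Longrightarrow> a < v" and vB: "\<And>b. b \<in> B \<Longrightarrow> v < b" by blast
  have v1: "1 < v" and vs: "\<And>p. p < m \<Longrightarrow> s p < v" using vA by (auto simp: A_def)
  have vup: "v < s p + 1" if "p < m" "\<not> nonrecord \<pi> p" "m \<le> q" "q < n" "\<pi> ! q < \<pi> ! p" for p q
    using vB that unfolding B_def by blast
  have ord1: "s p + lift \<pi> p < v + lift \<pi> m" if "p < m" "\<pi> ! p < \<pi> ! m" for p
  proof (cases "nonrecord \<pi> m \<and> \<not> nonrecord \<pi> p")
    case True
    then have "s p + 1 \<in> A" using that by (auto simp: A_def)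
    then show ?thesis using vA True by simp
  next
    case False
    then show ?thesis using vs[OF that(1)] by auto
  qed
  have ord2: "v + lift \<pi> m < s p + lift \<pi> p" if "p < m" "\<pi> ! m < \<pi> ! p" for p
  proof -
    have m: "nonrecord \<pi> m" using that by (auto simp: nonrecord_def)
    have p: "\<not> nonrecord \<pi> p" using low[of p m] that \<open>m < n\<close> by auto
    show ?thesis using vup[of p m] m p that \<open>m < n\<close> by simp
  qed
  show ?case
  proof (intro exI[of _ "s(m := v)"] conjI allI impI)
    fix p q assume "p < Suc m" "q < Suc m" "\<pi> ! p < \<pi> ! q"
    then show "(s(m := v)) p + lift \<pi> p < (s(m := v)) q + lift \<pi> q"
      using ord[of p q] ord1[of p] ord2[of q] by (cases "p = m"; cases "q = m") simp_all
  next
    fix p r assume p: "p < Suc m" and r: "r < Suc m"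
      and *: "\<not> nonrecord \<pi> p \<and> (\<exists>q\<ge>Suc m. q < n \<and> \<pi> ! q < \<pi> ! p)"
    then obtain q where q: "m \<le> q" "q < n" "\<pi> ! q < \<pi> ! p" by (auto dest: Suc_leD)
    show "(s(m := v)) r < (s(m := v)) p + 1"
      using p r * q inv[of p q r] vup[of p q] vs[of r] by (auto simp: less_Suc_eq)
  qed (use gt1 inc v1 vs in \<open>auto simp: less_Suc_eq\<close>)
qed

text \<open>Integer and fractional parts turn the order of the reals into a lexicographic one.
  Lifting by 1 leaves the fraction alone, so a single \<open>t\<close> serves columns and rows.
  Abscissae above 1 leave column 0 empty.\<close>

lemma staircase_drawing:
  assumes \<pi>: "\<pi> \<in> S321 n"
  obtains c :: "nat \<Rightarrow> nat" and b :: "nat \<Rightarrow> nat" and t :: "nat \<Rightarrow> real"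
  where "\<And>p. p < n \<Longrightarrow> 1 \<le> c p" "\<And>p. b p \<le> 1"
    "\<And>p q. p < q \<Longrightarrow> q < n \<Longrightarrow> (c p, t p) < (c q, t q)"
    "\<And>p q. p < n \<Longrightarrow> q < n \<Longrightarrow> \<pi> ! p < \<pi> ! q \<Longrightarrow> (c p + b p, t p) < (c q + b q, t q)"
proof -
  from parallel_lines_prefix[OF \<pi> order_refl] obtain s :: "nat \<Rightarrow> real" where
    s: "\<forall>p<n. 1 < s p" "\<forall>q<n. \<forall>p<q. s p < s q"
      "\<forall>p<n. \<forall>q<n. \<pi> ! p < \<pi> ! q \<longrightarrow> s p + lift \<pi> p < s q + lift \<pi> q"
    by (elim exE conjE)
  have gt1: "\<And>p. p < n \<Longrightarrow> 1 < s p" and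
    inc: "\<And>p q. q < n \<Longrightarrow> p < q \<Longrightarrow> s p < s q" and
    ord: "\<And>p q. p < n \<Longrightarrow> q < n \<Longrightarrow> \<pi> ! p < \<pi> ! q \<Longrightarrow> s p + lift \<pi> p < s q + lift \<pi> q"
    using s by simp_all
  define c where "c p = nat \<lfloor>s p\<rfloor>" for p
  define b :: "nat \<Rightarrow> nat" where "b p = of_bool (\<not> nonrecord \<pi> p)" for p
  have split: "s p = real (c p) + frac (s p)" if "p < n" for p
    using gt1[OF that] by (simp add: c_def frac_def)
  have lex: "(i, x) < (j, y)"
    if "real i + x < real j + y" "0 \<le> x" "x < 1" "0 \<le> y" "y < 1" for i j :: nat and x y :: real
  proof -
    have "i \<le> j" using that by linarith
    then show ?thesis using that by (auto simp: less_prod_simp)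
  qed
  have bl: "real (b p) = lift \<pi> p" for p by (simp add: b_def)
  show thesis
  proof (rule that[of c b "\<lambda>p. frac (s p)"])
    show "1 \<le> c p" if "p < n" for p using gt1[OF that] by (simp add: c_def le_nat_iff le_floor_iff)
    show "b p \<le> 1" for p by (simp add: b_def)
    show "(c p, frac (s p)) < (c q, frac (s q))" if "p < q" "q < n" for p q
      using inc[of q p] split[of p] split[of q] that by (intro lex) (auto simp: frac_lt_1)
    show "(c p + b p, frac (s p)) < (c q + b q, frac (s q))"
      if "p < n" "q < n" "\<pi> ! p < \<pi> ! q" for p q
      using ord[OF that] split[of p] split[of q] that bl
      by (intro lex) (auto simp: frac_lt_1)
  qed
qed

section \<open>Increasing maps with prescribed residues\<close>

text \<open>Elements are placed in increasing order of \<open>key\<close>, each at the first free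
  time or, in \<open>C\<close>, at the first free time with the right residue; such a wait takes
  fewer than \<open>k\<close> ticks.\<close>

lemma monotone_with_residues:
  fixes key :: "'a \<Rightarrow> 'b :: linorder" and \<rho> :: "'a \<Rightarrow> nat"
  assumes "finite A" "\<And>p. \<rho> p < k"
  shows "\<exists>\<tau> :: 'a \<Rightarrow> nat. (\<forall>p\<in>A. \<tau> p < card A + k * card (A \<inter> C)) \<and>
    (\<forall>p\<in>A. \<forall>q\<in>A. key p < key q \<longrightarrow> \<tau> p < \<tau> q) \<and> (\<forall>p\<in>A \<inter> C. \<tau> p mod k = \<rho> p)"
  using \<open>finite A\<close>
proof (induction A rule: finite_ranking_induct[where f = key])
  case empty
  then show ?case by simp
next
  case (insert x A)
  show ?case
  proof (cases "x \<in> A")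
    case True
    then show ?thesis using insert.IH by (simp add: insert_absorb)
  next
    case False
    define B where "B = card A + k * card (A \<inter> C)"
    from insert.IH obtain \<tau> where \<tau>: "\<And>p. p \<in> A \<Longrightarrow> \<tau> p < B"
      "\<And>p q. p \<in> A \<Longrightarrow> q \<in> A \<Longrightarrow> key p < key q \<Longrightarrow> \<tau> p < \<tau> q"
      "\<And>p. p \<in> A \<Longrightarrow> p \<in> C \<Longrightarrow> \<tau> p mod k = \<rho> p"
      unfolding B_def by blast
    \<comment> \<open>\<open>B\<close> is the first free time. In the case \<open>x \<in> C\<close>
      this is the least number from \<open>B\<close> on that is congruent to \<open>\<rho> x\<close>
      modulo \<open>k\<close>.\<close>
    define w where "w = (if x \<in> C then B + (\<rho> x + (k - B mod k)) mod k else B)"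
    have k: "0 < k" using assms(2)[of x] by simp
    have w: "B \<le> w" by (simp add: w_def)
    have res: "w mod k = \<rho> x" if "x \<in> C"
    proof -
      have "w mod k = (B mod k + (\<rho> x + (k - B mod k))) mod k"
        using that by (simp add: w_def mod_simps)
      also have "B mod k + (\<rho> x + (k - B mod k)) = \<rho> x + k"
        using mod_less_divisor[OF k, of B] by linarith
      finally show ?thesis using assms(2) by simp
    qed
    have card: "card (insert x A) + k * card (insert x A \<inter> C) = B + 1 + (if x \<in> C then k else 0)"
      using False insert.hyps by (simp add: B_def Int_insert_left)
    have wB: "w < B + 1 + (if x \<in> C then k else 0)"
      using mod_less_divisor[OF k, of "\<rho> x + (k - B mod k)"] unfolding w_def by (simp del: add_diff_assoc)
    show ?thesis unfolding card
    proof (intro exI[of _ "\<tau>(x := w)"] conjI ballI impI)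
      fix p q assume "p \<in> insert x A" "q \<in> insert x A" "key p < key q"
      moreover from this have "p \<noteq> x" using insert.hyps(2) by force
      ultimately show "(\<tau>(x := w)) p < (\<tau>(x := w)) q"
        using \<tau>(1)[of p] \<tau>(2)[of p q] w by auto
    next
      fix p assume "p \<in> insert x A"
      then show "(\<tau>(x := w)) p < B + 1 + (if x \<in> C then k else 0)"
        using \<tau>(1)[of p] wB by (cases "p = x") auto
    next
      fix p assume "p \<in> insert x A \<inter> C"
      then show "(\<tau>(x := w)) p mod k = \<rho> p" using \<tau>(3) res by auto
    qed
  qed
qed


section \<open>Permutations from finite point sets\<close>

text \<open>The points are read from left to right and replaced by the ranks of their heights. Ties
  in \<open>S\<close> are harmless, since the points chosen for \<open>\<pi>\<close> differ in both
  coordinates.\<close>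

lemma point_set_permutation:
  fixes S :: "('a :: linorder \<times> 'b :: linorder) set"
  assumes "finite S"
  obtains \<sigma> where "is_perm (card S) \<sigma>"
    "\<And>\<pi> X Y. distinct \<pi> \<Longrightarrow> (\<And>p. p < length \<pi> \<Longrightarrow> (X p, Y p) \<in> S) \<Longrightarrow>
      (\<And>p q. p < q \<Longrightarrow> q < length \<pi> \<Longrightarrow> X p < X q) \<Longrightarrow>
      (\<And>p q. p < length \<pi> \<Longrightarrow> q < length \<pi> \<Longrightarrow> \<pi> ! p < \<pi> ! q \<Longrightarrow> Y p < Y q) \<Longrightarrow>
      contains_pattern \<sigma> \<pi>"
proof -
  define xs where "xs = sorted_list_of_set S"
  \<comment> \<open>Height comes first; the abscissa breaks ties, so distinct points get distinct
    ranks.\<close>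
  define key where "key z = (snd z, fst z)" for z :: "'a \<times> 'b"
  define rk where "rk z = card {w \<in> S. key w \<le> key z}" for z
  have xs: "set xs = S" "distinct xs" "length xs = card S" "sorted xs"
    using assms by (simp_all add: xs_def)
  have rk_less: "rk z < rk w" if "z \<in> S" "w \<in> S" "key z < key w" for z w
    unfolding rk_def
  proof (rule psubset_card_mono)
    show "{v \<in> S. key v \<le> key z} \<subset> {v \<in> S. key v \<le> key w}"
      using that by (auto dest: leD)
  qed (use assms in simp)
  have inj: "inj_on rk S"
  proof (rule inj_onI)
    fix z w assume "z \<in> S" "w \<in> S" "rk z = rk w"
    then have "key z = key w"
      using rk_less[of z w] rk_less[of w z] by (cases "key z" "key w" rule: linorder_cases) auto
    then show "z = w" by (simp add: key_def prod_eq_iff)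
  qed
  have "rk ` S \<subseteq> {1..card S}"
  proof
    fix r assume "r \<in> rk ` S"
    then obtain z where z: "z \<in> S" "r = rk z" by blast
    have "{z} \<subseteq> {w \<in> S. key w \<le> key z}" using z by simp
    then have "1 \<le> rk z" unfolding rk_def using card_mono[of _ "{z}"] assms by fastforce
    moreover have "rk z \<le> card S" unfolding rk_def using assms by (intro card_mono) auto
    ultimately show "r \<in> {1..card S}" using z by simp
  qed
  then have img: "rk ` S = {1..card S}"
    using card_image[OF inj] by (intro card_subset_eq) auto
  show thesis
  proof (rule that[of "map rk xs"])
    show "is_perm (card S) (map rk xs)"
      using xs inj img by (simp add: is_perm_def distinct_map)
    fix \<pi> :: "nat list" and X :: "nat \<Rightarrow> 'a" and Y :: "nat \<Rightarrow> 'b"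
    assume dist: "distinct \<pi>" and mem: "\<And>p. p < length \<pi> \<Longrightarrow> (X p, Y p) \<in> S"
      and X: "\<And>p q. p < q \<Longrightarrow> q < length \<pi> \<Longrightarrow> X p < X q"
      and Y: "\<And>p q. p < length \<pi> \<Longrightarrow> q < length \<pi> \<Longrightarrow> \<pi> ! p < \<pi> ! q \<Longrightarrow> Y p < Y q"
    have "\<forall>p. \<exists>a. p < length \<pi> \<longrightarrow> a < length xs \<and> xs ! a = (X p, Y p)"
      using mem xs(1) by (metis in_set_conv_nth)
    then obtain l where l: "\<And>p. p < length \<pi> \<Longrightarrow> l p < length xs \<and> xs ! l p = (X p, Y p)"
      by metis
    have less: "map rk xs ! l p < map rk xs ! l q"
      if "p < length \<pi>" "q < length \<pi>" "\<pi> ! p < \<pi> ! q" for p q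
      using l that mem rk_less[of "(X p, Y p)" "(X q, Y q)"] Y by (simp add: key_def)
    show "contains_pattern (map rk xs) \<pi>"
      unfolding contains_pattern_def
    proof (intro exI[of _ l] conjI allI impI iffI)
      fix i j assume ij: "i < j \<and> j < length \<pi>"
      show "l i < l j"
      proof (rule ccontr)
        assume "\<not> l i < l j"
        then have "xs ! l j \<le> xs ! l i" using xs(4) l[of i] ij by (intro sorted_nth_mono) auto
        then show False using X[of i j] ij l[of i] l[of j] by auto
      qed
    next
      fix i j assume ij: "i < length \<pi>" "j < length \<pi>" "map rk xs ! l i < map rk xs ! l j"
      then have "\<pi> ! i \<noteq> \<pi> ! j" using dist by (auto simp: nth_eq_iff_index_eq)
      then show "\<pi> ! i < \<pi> ! j" using less[OF ij(2,1)] ij(3) by linarith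
    qed (use l less in auto)
  qed
qed

section \<open>Heavy and light integers\<close>

text \<open>
  \<open>c\<close> is the column of a point, \<open>c + b\<close> its row, \<open>t\<close> its time within the cell, and \<open>v\<close> its value.
\<close>
locale staircase =
  fixes n k :: nat and c b :: "nat \<Rightarrow> nat" and t :: "nat \<Rightarrow> real" and v :: "nat \<Rightarrow> nat"
  assumes k_pos: "0 < k"
    and c_pos: "\<And>p. p < n \<Longrightarrow> 1 \<le> c p"
    and b_le: "\<And>p. b p \<le> 1"
    and x_order: "\<And>p q. p < q \<Longrightarrow> q < n \<Longrightarrow> (c p, t p) < (c q, t q)"
    and y_order: "\<And>p q. p < n \<Longrightarrow> q < n \<Longrightarrow> v p < v q \<Longrightarrow> (c p + b p, t p) < (c q + b q, t q)"
begin

definition before :: "nat \<Rightarrow> nat" where "before i = card {p. p < n \<and> c p < i}"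

definition heavy :: "nat \<Rightarrow> bool" where "heavy i \<longleftrightarrow> before i div k < before (Suc i) div k"

primrec heavies :: "nat \<Rightarrow> nat" where
  "heavies 0 = 0"
| "heavies (Suc i) = heavies i + of_bool (heavy i)"

text \<open>Serves as the name of a clock: a block of consecutive heavy integers is governed by the
  light integer just before it. The value at 0 fits because 0 is light.\<close>

primrec last_light :: "nat \<Rightarrow> nat" where
  "last_light 0 = 0"
| "last_light (Suc i) = (if heavy (Suc i) then last_light i else Suc i)"

lemma before_mono: "i \<le> j \<Longrightarrow> before i \<le> before j"
  unfolding before_def by (intro card_mono) auto

lemma before_le: "before i \<le> n"
  unfolding before_def by (rule order_trans[OF card_mono[of "{..<n}"]]) auto

lemma light_0: "\<not> heavy 0"
proof -
  have "{p. p < n \<and> c p < Suc 0} = {}" using c_pos by force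
  then have "before (Suc 0) = 0" by (simp add: before_def)
  then show ?thesis by (simp add: heavy_def)
qed

lemma heavies_mono: "i \<le> j \<Longrightarrow> heavies i \<le> heavies j"
  by (rule lift_Suc_mono_le[of heavies]) auto

text \<open>Each heavy integer raises \<open>before i div k\<close> by at least 1.\<close>

lemma heavies_le: "heavies i \<le> n div k"
proof -
  have "heavies i \<le> before i div k"
  proof (induction i)
    case (Suc i)
    have "before i div k \<le> before (Suc i) div k" by (simp add: before_mono div_le_mono)
    with Suc show ?case by (auto simp: heavy_def)
  qed simp
  also have "\<dots> \<le> n div k" by (simp add: before_le div_le_mono)
  finally show ?thesis .
qed

lemma before_div_eq: "i \<le> j \<Longrightarrow> heavies i = heavies j \<Longrightarrow> before i div k = before j div k"
proof (induction j rule: dec_induct)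
  case (step j)
  have "heavies i \<le> heavies j" using step by (intro heavies_mono)
  then have "\<not> heavy j" "heavies i = heavies j" using step.prems by (auto simp: of_bool_def split: if_splits)
  then show ?case using step.IH before_mono[of j "Suc j"]
    by (simp add: heavy_def div_le_mono order.antisym)
qed simp

lemma c_mono: "p \<le> q \<Longrightarrow> q < n \<Longrightarrow> c p \<le> c q"
  using x_order[of p q] by (cases "p = q") auto

text \<open>Columns weakly increase with position, so column \<open>c p\<close> occupies the
  positions from \<open>before (c p)\<close> to just below \<open>before (Suc (c p))\<close>; for a
  light column both bounds have the same quotient.\<close>

lemma light_index_div:
  assumes "p < n" "\<not> heavy (c p)"
  shows "p div k = before (c p) div k"
proof -
  have "{q. q < n \<and> c q < c p} \<subseteq> {..<p}"
    using c_mono[of p] by (auto simp: not_le[symmetric])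
  then have "before (c p) \<le> p" unfolding before_def using card_mono[of "{..<p}"] by fastforce
  moreover have "{..p} \<subseteq> {q. q < n \<and> c q < Suc (c p)}"
    using c_mono[of _ p] assms(1) by (auto simp: less_Suc_eq_le)
  then have "p < before (Suc (c p))"
    unfolding before_def using card_mono[of "{q. q < n \<and> c q < Suc (c p)}" "{..p}"] by simp
  ultimately have "before (c p) div k \<le> p div k" "p div k \<le> before (Suc (c p)) div k"
    by (simp_all add: div_le_mono)
  with assms(2) show ?thesis by (simp add: heavy_def)
qed

definition light_run :: "nat \<Rightarrow> nat set" where
  "light_run j = {p. p < n \<and> \<not> heavy (c p) \<and> heavies (c p) = j}"

text \<open>Within a run \<open>p mod k\<close> can therefore replace \<open>p\<close> as horizontal
  coordinate, and the run fits into \<open>k\<close> consecutive positions.\<close>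

lemma light_run_div:
  assumes "p \<in> light_run j" "q \<in> light_run j"
  shows "p div k = q div k"
proof -
  have "heavies (c p) = heavies (c q)" using assms by (simp add: light_run_def)
  then have "before (c p) div k = before (c q) div k"
    using before_div_eq[of "c p" "c q"] before_div_eq[of "c q" "c p"] by (metis nat_le_linear)
  then show ?thesis
    using light_index_div[of p] light_index_div[of q] assms by (simp add: light_run_def)
qed

lemma finite_light_run: "finite (light_run j)"
  by (simp add: light_run_def)

lemma card_light_run: "card (light_run j) \<le> k"
proof (cases "light_run j = {}")
  case False
  then obtain p where p: "p \<in> light_run j" by blast
  have "light_run j \<subseteq> {p div k * k..<p div k * k + k}"
  proof
    fix q assume "q \<in> light_run j"
    then have "q div k = p div k" using p light_run_div by blast
    then show "q \<in> {p div k * k..<p div k * k + k}"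
      using div_mult_mod_eq[of q k] mod_less_divisor[OF k_pos, of q]
      by (simp del: mod_less_divisor)
  qed
  then show ?thesis using card_mono[of "{p div k * k..<p div k * k + k}"] by simp
qed simp

lemma last_light_le: "last_light i \<le> i"
  by (induction i) auto

lemma last_light_ge: "\<not> heavy i \<Longrightarrow> i \<le> j \<Longrightarrow> i \<le> last_light j"
proof (induction j)
  case (Suc j)
  then show ?case by (cases "i = Suc j") auto
qed simp

lemma last_light_light: "\<not> heavy i \<Longrightarrow> last_light i = i"
  by (cases i) auto

lemma last_light_heavy: "heavy i \<Longrightarrow> last_light i = last_light (i - 1)"
  using light_0 by (cases i) auto

section \<open>Clocks\<close>

text \<open>The entries of light column \<open>e\<close> and of the next light column. Only these
  light columns can meet the rows timed by clock \<open>e\<close>.\<close>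

definition clocked :: "nat \<Rightarrow> nat set" where
  "clocked e = {p. p < n \<and> \<not> heavy (c p) \<and> (c p = e \<or> last_light (c p - 1) = e)}"

lemma card_clocked: "card (clocked e) \<le> 2 * k"
proof -
  define C where "C = {p. p < n \<and> \<not> heavy (c p) \<and> last_light (c p - 1) = e}"
  \<comment> \<open>If \<open>c q < c p\<close>, then \<open>e\<close> is at least the light integer
    \<open>c q\<close>; but \<open>e = last_light (c q - 1)\<close> is smaller. By symmetry
    \<open>C\<close> lies in one column.\<close>
  have le: "c p \<le> c q" if "p \<in> C" "q \<in> C" for p q
  proof (rule ccontr)
    assume "\<not> c p \<le> c q"
    then have "c q \<le> last_light (c p - 1)" using that by (intro last_light_ge) (auto simp: C_def)
    moreover have "last_light (c q - 1) < c q"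
      using last_light_le[of "c q - 1"] c_pos[of q] that by (auto simp: C_def)
    ultimately show False using that by (auto simp: C_def)
  qed
  have "card C \<le> k"
  proof (cases "C = {}")
    case False
    then obtain p where "p \<in> C" by blast
    then have "C \<subseteq> light_run (heavies (c p))"
      using le by (auto simp: light_run_def C_def intro!: arg_cong[of _ _ heavies] order.antisym)
    then show ?thesis using card_light_run card_mono[OF finite_light_run] order_trans by blast
  qed simp
  moreover have "clocked e \<subseteq> light_run (heavies e) \<union> C"
    by (auto simp: clocked_def light_run_def C_def)
  then have "card (clocked e) \<le> card (light_run (heavies e)) + card C"
    using finite_light_run
    by (intro order_trans[OF card_mono card_Un_le]) (auto simp: C_def)
  ultimately show ?thesis using card_light_run[of "heavies e"] by simp
qed

text \<open>The target residue of an entry is that of its position; at most \<open>2 * k\<close>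
  delays give the extra length \<open>2 * k * k\<close>.\<close>

lemma clock_exists:
  "\<exists>\<tau> :: nat \<Rightarrow> nat. (\<forall>p<n. \<tau> p < n + 2 * k * k) \<and>
     (\<forall>p<n. \<forall>q<n. t p < t q \<longrightarrow> \<tau> p < \<tau> q) \<and> (\<forall>p\<in>clocked e. \<tau> p mod k = p mod k)"
proof -
  have sub: "{..<n} \<inter> clocked e = clocked e" by (auto simp: clocked_def)
  obtain \<tau> :: "nat \<Rightarrow> nat" where \<tau>: "\<forall>p\<in>{..<n}. \<tau> p < card {..<n} + k * card ({..<n} \<inter> clocked e)"
    "\<forall>p\<in>{..<n}. \<forall>q\<in>{..<n}. t p < t q \<longrightarrow> \<tau> p < \<tau> q" "\<forall>p\<in>{..<n} \<inter> clocked e. \<tau> p mod k = p mod k"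
    using monotone_with_residues[of "{..<n}" "\<lambda>p. p mod k" k "clocked e" t] k_pos by auto
  have "k * card (clocked e) \<le> 2 * k * k" using card_clocked[of e] by simp
  then have "\<tau> p < n + 2 * k * k" if "p < n" for p
    using \<tau>(1) that unfolding sub card_lessThan by (meson add_left_mono lessThan_iff less_le_trans)
  with \<tau>(2,3) show ?thesis unfolding sub by (intro exI[of _ \<tau>]) simp
qed

definition clock :: "nat \<Rightarrow> nat \<Rightarrow> nat" where
  "clock e = (SOME \<tau>. (\<forall>p<n. \<tau> p < n + 2 * k * k) \<and>
     (\<forall>p<n. \<forall>q<n. t p < t q \<longrightarrow> \<tau> p < \<tau> q) \<and> (\<forall>p\<in>clocked e. \<tau> p mod k = p mod k))"

lemma clock_less: "p < n \<Longrightarrow> clock e p < n + 2 * k * k"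
  and clock_mono: "p < n \<Longrightarrow> q < n \<Longrightarrow> t p < t q \<Longrightarrow> clock e p < clock e q"
  and clock_mod: "p \<in> clocked e \<Longrightarrow> clock e p mod k = p mod k"
  using someI_ex[OF clock_exists[of e], folded clock_def] by simp_all

text \<open>The vertical coordinate in the \<open>k\<close> by \<open>k\<close> grid of a light
  run.\<close>

definition light_rank :: "nat \<Rightarrow> nat" where
  "light_rank p = card {q \<in> light_run (heavies (c p)). v q < v p}"

lemma light_rank_less: "p \<in> light_run j \<Longrightarrow> light_rank p < k"
proof -
  assume p: "p \<in> light_run j"
  then have "{q \<in> light_run j. v q < v p} \<subset> light_run j" by auto
  then have "card {q \<in> light_run j. v q < v p} < card (light_run j)"
    by (intro psubset_card_mono finite_light_run)
  with p card_light_run[of j] show ?thesis by (simp add: light_rank_def light_run_def)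
qed

lemma light_rank_mono:
  assumes "p \<in> light_run j" "q \<in> light_run j" "v p < v q"
  shows "light_rank p < light_rank q"
proof -
  have "{r \<in> light_run j. v r < v p} \<subset> {r \<in> light_run j. v r < v q}"
  proof (rule psubsetI)
    show "{r \<in> light_run j. v r < v p} \<subseteq> {r \<in> light_run j. v r < v q}"
      using assms(3) by auto
    show "{r \<in> light_run j. v r < v p} \<noteq> {r \<in> light_run j. v r < v q}"
      using assms(1,3) by blast
  qed
  then have "card {r \<in> light_run j. v r < v p} < card {r \<in> light_run j. v r < v q}"
    using finite_light_run by (intro psubset_card_mono) auto
  with assms show ?thesis by (simp add: light_rank_def light_run_def)
qed

section \<open>Coordinates of the entries\<close>

text \<open>For equal \<open>heavies\<close> the order is: light row right after a heavy integer,
  other light rows, next heavy row. The first kind is kept apart because it also receives lifted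
  points of a heavy column and so follows a clock.\<close>

definition row_code :: "nat \<Rightarrow> nat" where
  "row_code r = 3 * heavies r + (if heavy r then 2 else if heavy (r - 1) then 0 else 1)"

definition col_code :: "nat \<Rightarrow> nat" where
  "col_code i = 2 * heavies i + of_bool (heavy i)"

lemma col_code_mono: "i \<le> j \<Longrightarrow> col_code i \<le> col_code j"
  by (rule lift_Suc_mono_le[of col_code]) (auto simp: col_code_def)

lemma row_code_mono: "i \<le> j \<Longrightarrow> row_code i \<le> row_code j"
  by (rule lift_Suc_mono_le[of row_code]) (auto simp: row_code_def)

text \<open>Only light rows preceded by a light integer are merged; a row that follows a clock keeps
  its own code.\<close>

lemma row_code_less: "r < r' \<Longrightarrow> heavy r \<or> heavy (r - 1) \<Longrightarrow> row_code r < row_code r'"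
proof -
  assume "r < r'" "heavy r \<or> heavy (r - 1)"
  moreover from this have "row_code r < row_code (Suc r)" by (auto simp: row_code_def)
  ultimately show ?thesis using row_code_mono[of "Suc r" r'] by simp
qed

lemma col_code_less: "i < j \<Longrightarrow> heavy i \<Longrightarrow> col_code i < col_code j"
proof -
  assume "i < j" "heavy i"
  moreover from this have "col_code i < col_code (Suc i)" by (auto simp: col_code_def)
  ultimately show ?thesis using col_code_mono[of "Suc i" j] by simp
qed

text \<open>A heavy column \<open>i\<close> and its rows \<open>i\<close> and \<open>i + 1\<close>
  read the same clock, as \<open>last_light i = last_light (i - 1)\<close>; this puts its points on
  diagonals.\<close>

definition X :: "nat \<Rightarrow> nat \<times> nat" where
  "X p = (col_code (c p), if heavy (c p) then clock (last_light (c p - 1)) p else p mod k)"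

definition Y :: "nat \<Rightarrow> nat \<times> nat" where
  "Y p = (let r = c p + b p in
     (row_code r, if heavy r \<or> heavy (r - 1) then clock (last_light (r - 1)) p else light_rank p))"

lemma X_less:
  assumes "p < q" "q < n"
  shows "X p < X q"
proof -
  have o: "c p < c q \<or> c p = c q \<and> t p < t q" using x_order[OF assms] by auto
  then have le: "col_code (c p) \<le> col_code (c q)" by (intro col_code_mono) auto
  show ?thesis
  proof (cases "col_code (c p) < col_code (c q)")
    case True
    then show ?thesis by (simp add: X_def)
  next
    case False
    with le have eq: "col_code (c p) = col_code (c q)" by simp
    show ?thesis
    proof (cases "heavy (c p)")
      case True
      then have "c p = c q" "t p < t q" using o eq col_code_less[of "c p" "c q"] by auto
      then show ?thesis using True clock_mono assms by (simp add: X_def)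
    next
      case False
      \<comment> \<open>The parity of a column code tells heavy from light, so both entries lie in
        one light run; equal quotients pass \<open>p < q\<close> on to the remainders.\<close>
      have hq: "\<not> heavy (c q)" "heavies (c q) = heavies (c p)"
        using False eq by (auto simp: col_code_def of_bool_def split: if_splits) presburger+
      then have "p div k = q div k"
        using False assms by (intro light_run_div[of _ "heavies (c p)"]) (auto simp: light_run_def)
      then have "p mod k < q mod k"
        using assms by (metis div_mult_mod_eq nat_add_left_cancel_less)
      then show ?thesis using False hq eq by (simp add: X_def)
    qed
  qed
qed

text \<open>For a lifted entry the column is the light integer below the row, and passing a light
  integer leaves \<open>heavies\<close> unchanged.\<close>

lemma light_row:
  assumes "p < n" "\<not> heavy (c p + b p)" "\<not> heavy (c p + b p - 1)"
  shows "p \<in> light_run (heavies (c p + b p))"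
  using assms b_le[of p] by (cases "b p") (auto simp: light_run_def)

lemma Y_less:
  assumes "p < n" "q < n" "v p < v q"
  shows "Y p < Y q"
proof -
  let ?r = "c p + b p" and ?s = "c q + b q"
  have o: "?r < ?s \<or> ?r = ?s \<and> t p < t q" using y_order[OF assms] by auto
  then have le: "row_code ?r \<le> row_code ?s" by (intro row_code_mono) auto
  show ?thesis
  proof (cases "row_code ?r < row_code ?s")
    case True
    then show ?thesis by (simp add: Y_def Let_def)
  next
    case False
    with le have eq: "row_code ?r = row_code ?s" by simp
    show ?thesis
    proof (cases "heavy ?r \<or> heavy (?r - 1)")
      case True
      then have "?r = ?s" "t p < t q" using o eq row_code_less[of ?r ?s] by auto
      then show ?thesis using True clock_mono assms by (simp add: Y_def Let_def)
    next
      case False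
      \<comment> \<open>The code of \<open>?r\<close> is 1 modulo 3, which forces \<open>?s\<close>
        to be of the same kind; both entries are then ranked within one run.\<close>
      then have "\<not> heavy ?s" "\<not> heavy (?s - 1)" "heavies ?s = heavies ?r"
        using eq by (auto simp: row_code_def split: if_splits) presburger+
      moreover from this have "light_rank p < light_rank q"
        using False assms light_row[of p] light_row[of q] by (intro light_rank_mono) auto
      ultimately show ?thesis using False eq by (simp add: Y_def Let_def)
    qed
  qed
qed

end

section \<open>The universal point set\<close>

text \<open>
  Columns \<open>2 * j\<close> and rows \<open>3 * j + 1\<close> serve the \<open>j\<close>-th light run, columns \<open>2 * j + 1\<close> and rows
  \<open>3 * j + 2\<close> the \<open>j\<close>-th heavy integer, and rows \<open>3 * j\<close> the light integer, if any, that directly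
  follows a heavy one. Cells belonging to light columns and heavy rows contain only the
  points \<open>(u mod k, u)\<close>, the clocks having been adjusted to hit these residues.
\<close>
definition universal_set :: "nat \<Rightarrow> nat \<Rightarrow> ((nat \<times> nat) \<times> (nat \<times> nat)) set" where
  "universal_set n k = (\<Union>j\<in>{..n div k}.
     (\<lambda>u. ((2 * j + 1, u), (3 * j + 2, u))) ` {..<n + 2 * k * k} \<union>
     (\<lambda>u. ((2 * j + 1, u), (3 * j + 3, u))) ` {..<n + 2 * k * k} \<union>
     (\<lambda>u. ((2 * j + 1, u), (3 * j + 5, u))) ` {..<n + 2 * k * k} \<union>
     (\<lambda>u. ((2 * j, u mod k), (3 * j, u))) ` {..<n + 2 * k * k} \<union>
     (\<lambda>u. ((2 * j, u mod k), (3 * j + 2, u))) ` {..<n + 2 * k * k} \<union>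
     (\<lambda>(x, y). ((2 * j, x), (3 * j + 1, y))) ` ({..<k} \<times> {..<k}))"

lemma finite_universal_set: "finite (universal_set n k)"
  unfolding universal_set_def
  by (intro finite_UN_I finite_UnI finite_imageI finite_cartesian_product finite_lessThan finite_atMost)

lemma card_universal_set:
  "card (universal_set n k) \<le> (n div k + 1) * (5 * (n + 2 * k * k) + k * k)"
proof -
  have im: "card (f ` {..<m}) \<le> m" for f :: "nat \<Rightarrow> (nat \<times> nat) \<times> (nat \<times> nat)" and m
    using card_image_le[of "{..<m}" f] by simp
  have im2: "card (f ` ({..<k} \<times> {..<k})) \<le> k * k" for f :: "nat \<times> nat \<Rightarrow> (nat \<times> nat) \<times> (nat \<times> nat)"
    using card_image_le[of "{..<k} \<times> {..<k}" f] by (simp add: card_cartesian_product)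
  have un: "card (A \<union> B) \<le> x + y" if "card A \<le> x" "card B \<le> y"
    for A B :: "((nat \<times> nat) \<times> (nat \<times> nat)) set" and x y
    using card_Un_le[of A B] that by linarith
  have "card (universal_set n k) \<le> (\<Sum>j\<in>{..n div k}.
      (n + 2 * k * k) + (n + 2 * k * k) + (n + 2 * k * k) + (n + 2 * k * k) + (n + 2 * k * k) + k * k)"
    unfolding universal_set_def
    by (rule order_trans[OF card_UN_le], simp, intro sum_mono un im im2)
  then show ?thesis by (simp add: algebra_simps)
qed

lemma universal_set_intros:
  assumes "j \<le> n div k"
  shows "u < n + 2 * k * k \<Longrightarrow> ((2 * j + 1, u), (3 * j + 2, u)) \<in> universal_set n k"
    and "u < n + 2 * k * k \<Longrightarrow> ((2 * j + 1, u), (3 * j + 3, u)) \<in> universal_set n k"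
    and "u < n + 2 * k * k \<Longrightarrow> ((2 * j + 1, u), (3 * j + 5, u)) \<in> universal_set n k"
    and "u < n + 2 * k * k \<Longrightarrow> ((2 * j, u mod k), (3 * j, u)) \<in> universal_set n k"
    and "u < n + 2 * k * k \<Longrightarrow> ((2 * j, u mod k), (3 * j + 2, u)) \<in> universal_set n k"
    and "x < k \<Longrightarrow> y < k \<Longrightarrow> ((2 * j, x), (3 * j + 1, y)) \<in> universal_set n k"
  unfolding universal_set_def using assms
  by (intro UN_I[of j] UnI1 UnI2 image_eqI[of _ _ u] image_eqI[of _ _ "(x, y)"] SigmaI; simp)+

context staircase
begin

text \<open>Heavy columns give diagonal cells, light columns with clocked rows rely on
  \<open>clock_mod\<close>, and all other cells are full grids.\<close>

lemma mem_universal_set: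
  assumes p: "p < n"
  shows "(X p, Y p) \<in> universal_set n k"
proof -
  define i where "i = c p"
  define j where "j = heavies i"
  have j: "j \<le> n div k" by (simp add: j_def heavies_le)
  have T: "clock e p < n + 2 * k * k" for e using clock_less[OF p] .
  consider "b p = 0" | "b p = 1" using b_le[of p] by linarith
  then show ?thesis
  proof cases
    case b: 1
    consider "heavy i" | "\<not> heavy i" "heavy (i - 1)" | "\<not> heavy i" "\<not> heavy (i - 1)" by blast
    then show ?thesis
    proof cases
      case 1
      then have "X p = (2 * j + 1, clock (last_light (i - 1)) p)"
        "Y p = (3 * j + 2, clock (last_light (i - 1)) p)"
        using b by (auto simp: X_def Y_def Let_def col_code_def row_code_def i_def j_def)
      then show ?thesis using universal_set_intros[OF j] T by simp
    next
      case 2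
      have "p \<in> clocked (last_light (i - 1))" using 2 p by (simp add: clocked_def i_def)
      from clock_mod[OF this] 2 have "X p = (2 * j, clock (last_light (i - 1)) p mod k)"
        "Y p = (3 * j, clock (last_light (i - 1)) p)"
        using b by (auto simp: X_def Y_def Let_def col_code_def row_code_def i_def j_def)
      then show ?thesis using universal_set_intros[OF j] T by simp
    next
      case 3
      then have "X p = (2 * j, p mod k)" "Y p = (3 * j + 1, light_rank p)"
        using b by (auto simp: X_def Y_def Let_def col_code_def row_code_def i_def j_def)
      moreover have "light_rank p < k"
        using light_rank_less[of p j] 3 p by (simp add: light_run_def i_def j_def)
      ultimately show ?thesis using universal_set_intros[OF j] k_pos by simp
    qed
  next
    case b: 2
    consider "heavy i" "heavy (Suc i)" | "heavy i" "\<not> heavy (Suc i)"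
      | "\<not> heavy i" "heavy (Suc i)" | "\<not> heavy i" "\<not> heavy (Suc i)" by blast
    then show ?thesis
    proof cases
      case 1
      \<comment> \<open>Row \<open>i + 1\<close> comes after heavy \<open>i\<close>, so its code
        uses \<open>j + 1\<close>: hence \<open>3 * j + 5\<close> here and \<open>3 * j + 3\<close>
        in the next case.\<close>
      then have "X p = (2 * j + 1, clock (last_light i) p)" "Y p = (3 * j + 5, clock (last_light i) p)"
        using b last_light_heavy[of i] by (auto simp: X_def Y_def Let_def col_code_def row_code_def i_def j_def)
      then show ?thesis using universal_set_intros[OF j] T by simp
    next
      case 2
      then have "X p = (2 * j + 1, clock (last_light i) p)" "Y p = (3 * j + 3, clock (last_light i) p)"
        using b last_light_heavy[of i] by (auto simp: X_def Y_def Let_def col_code_def row_code_def i_def j_def)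
      then show ?thesis using universal_set_intros[OF j] T by simp
    next
      case 3
      \<comment> \<open>Here \<open>last_light i = i\<close>: the heavy row above runs on the clock
        named after the light column itself.\<close>
      have "p \<in> clocked i" using 3 p by (simp add: clocked_def i_def)
      from clock_mod[OF this] 3 have "X p = (2 * j, clock i p mod k)" "Y p = (3 * j + 2, clock i p)"
        using b last_light_light[of i]
        by (auto simp: X_def Y_def Let_def col_code_def row_code_def i_def j_def)
      then show ?thesis using universal_set_intros[OF j] T by simp
    next
      case 4
      then have "X p = (2 * j, p mod k)" "Y p = (3 * j + 1, light_rank p)"
        using b by (auto simp: X_def Y_def Let_def col_code_def row_code_def i_def j_def)
      moreover have "light_rank p < k"
        using light_rank_less[of p j] 4 p by (simp add: light_run_def i_def j_def)
      ultimately show ?thesis using universal_set_intros[OF j] k_pos by simp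
    qed
  qed
qed

end

lemma superpattern_S321:
  assumes "0 < k" "card (universal_set n k) \<le> N"
  shows "\<exists>\<sigma>. is_perm N \<sigma> \<and> superpattern (S321 n) \<sigma>"
proof -
  have "infinite (UNIV :: ((nat \<times> nat) \<times> (nat \<times> nat)) set)"
    by (simp add: finite_prod)
  then obtain E where E: "finite E" "card E = N - card (universal_set n k)" "universal_set n k \<inter> E = {}"
    using finite_arbitrarily_large_disj[OF _ finite_universal_set] by metis
  define S where "S = universal_set n k \<union> E"
  have S: "finite S" "card S = N"
    using E assms(2) finite_universal_set by (auto simp: S_def card_Un_disjoint)
  obtain \<sigma> where \<sigma>: "is_perm (card S) \<sigma>"
    "\<And>\<pi> X Y. distinct \<pi> \<Longrightarrow> (\<And>p. p < length \<pi> \<Longrightarrow> (X p, Y p) \<in> S) \<Longrightarrow>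
      (\<And>p q. p < q \<Longrightarrow> q < length \<pi> \<Longrightarrow> X p < X q) \<Longrightarrow>
      (\<And>p q. p < length \<pi> \<Longrightarrow> q < length \<pi> \<Longrightarrow> \<pi> ! p < \<pi> ! q \<Longrightarrow> Y p < Y q) \<Longrightarrow>
      contains_pattern \<sigma> \<pi>"
    by (fact point_set_permutation[OF S(1)])
  have "contains_pattern \<sigma> \<pi>" if \<pi>: "\<pi> \<in> S321 n" for \<pi>
  proof -
    have len: "length \<pi> = n" "distinct \<pi>" using \<pi> by (auto simp: S321_def is_perm_def)
    obtain c b :: "nat \<Rightarrow> nat" and t :: "nat \<Rightarrow> real" where
      "\<And>p. p < n \<Longrightarrow> 1 \<le> c p" "\<And>p. b p \<le> 1"
      "\<And>p q. p < q \<Longrightarrow> q < n \<Longrightarrow> (c p, t p) < (c q, t q)"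
      "\<And>p q. p < n \<Longrightarrow> q < n \<Longrightarrow> \<pi> ! p < \<pi> ! q \<Longrightarrow> (c p + b p, t p) < (c q + b q, t q)"
      by (fact staircase_drawing[OF \<pi>])
    with assms(1) interpret staircase n k c b t "\<lambda>p. \<pi> ! p" by unfold_locales
    show ?thesis
      by (rule \<sigma>(2)[of \<pi> X Y]) (use len mem_universal_set X_less Y_less in \<open>auto simp: S_def\<close>)
  qed
  then show ?thesis using \<sigma>(1) S(2) by (auto simp: superpattern_def)
qed

section \<open>Size estimate and asymptotics\<close>

lemma universal_set_size_bound:
  fixes n :: nat
  assumes "1 \<le> n"
  defines "k \<equiv> nat \<lceil>sqrt (real n)\<rceil>"
  shows "0 < k" "real (card (universal_set n k)) \<le> 22 * real n powr (3/2) + 82 * real n"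
proof -
  define x where "x = sqrt (real n)"
  have x: "1 \<le> x" "x * x = real n" using assms(1) by (simp_all add: x_def)
  have k: "x \<le> real k" "real k \<le> x + 1" using x(1) unfolding k_def x_def by linarith+
  show "0 < k" using k x by (cases k) auto
  have "real (n div k) \<le> real n / real k" by (rule of_nat_div_le_of_nat)
  also have "\<dots> \<le> real n / x" using k x by (intro divide_left_mono) auto
  also have "\<dots> = x" using x by (simp add: field_simps)
  finally have d: "real (n div k) \<le> x" .
  have kk: "real k * real k \<le> (x + 1) * (x + 1)" using k x by (intro mult_mono) auto
  have xs: "x * x \<le> x * x * x" "x \<le> x * x" "1 \<le> x * x"
    using x(1) mult_mono[of 1 x 1 x] mult_left_mono[of 1 x x] mult_left_mono[of 1 x "x * x"] by auto
  have pw: "real n powr (3/2) = x * x * x"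
  proof -
    have "real n powr (3/2) = real n powr 1 * real n powr (1/2)"
      by (subst powr_add[symmetric]) simp
    then show ?thesis using x by (simp add: powr_half_sqrt x_def)
  qed
  have "real (card (universal_set n k)) \<le> real ((n div k + 1) * (5 * (n + 2 * k * k) + k * k))"
    using card_universal_set of_nat_mono by blast
  also have "\<dots> = (real (n div k) + 1) * (5 * real n + 11 * (real k * real k))"
    by (simp add: algebra_simps)
  also have "\<dots> \<le> (x + 1) * (5 * (x * x) + 11 * ((x + 1) * (x + 1)))"
    using d kk x by (intro mult_mono) auto
  also have "\<dots> = 16 * (x * x * x) + 38 * (x * x) + 33 * x + 11" by (simp add: algebra_simps)
  \<comment> \<open>Here 82 = 38 + 33 + 11, the lower terms being bounded by \<open>x * x\<close>;
    16 is relaxed to 22.\<close>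
  also have "\<dots> \<le> 22 * (x * x * x) + 82 * (x * x)" using xs by linarith
  finally show "real (card (universal_set n k)) \<le> 22 * real n powr (3/2) + 82 * real n"
    using pw x by simp
qed

theorem theorem6:
  shows "\<exists>f :: nat \<Rightarrow> real. f \<in> \<Theta>(\<lambda>n. real n) \<and>
           (\<forall>n \<ge> 1. \<exists>\<sigma> N. is_perm N \<sigma> \<and>
              real N = 22 * real n powr (3/2) + f n \<and>
              superpattern (S321 n) \<sigma>)"
proof -
  \<comment> \<open>The universal set is padded to this rounded length, so \<open>f n\<close> lies
    between \<open>82 * n\<close> and \<open>82 * n + 1\<close>, which is at most
    \<open>83 * n\<close> for positive \<open>n\<close>.\<close>
  define N where "N n = nat \<lceil>22 * real n powr (3/2) + 82 * real n\<rceil>" for n :: nat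
  define f where "f n = real (N n) - 22 * real n powr (3/2)" for n
  have N: "22 * real n powr (3/2) + 82 * real n \<le> real (N n)"
    "real (N n) \<le> 22 * real n powr (3/2) + 82 * real n + 1" for n
  proof -
    have "0 \<le> 22 * real n powr (3/2) + 82 * real n" by simp
    then show "22 * real n powr (3/2) + 82 * real n \<le> real (N n)"
      "real (N n) \<le> 22 * real n powr (3/2) + 82 * real n + 1" unfolding N_def by linarith+
  qed
  have "f \<in> \<Theta>(\<lambda>n. real n)"
  proof (rule bigthetaI')
    show "eventually (\<lambda>n. 82 * norm (real n) \<le> norm (f n) \<and> norm (f n) \<le> 83 * norm (real n)) sequentially"
    proof (rule eventually_sequentiallyI[of 1])
      fix n :: nat assume "1 \<le> n"
      then show "82 * norm (real n) \<le> norm (f n) \<and> norm (f n) \<le> 83 * norm (real n)"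
        using N[of n] by (simp add: f_def)
    qed
  qed simp_all
  moreover have "\<exists>\<sigma> M. is_perm M \<sigma> \<and> real M = 22 * real n powr (3/2) + f n \<and> superpattern (S321 n) \<sigma>"
    if "1 \<le> n" for n
  proof -
    define k where "k = nat \<lceil>sqrt (real n)\<rceil>"
    have k: "0 < k" "real (card (universal_set n k)) \<le> real (N n)"
      using universal_set_size_bound[OF that] N(1)[of n] unfolding k_def by linarith+
    then obtain \<sigma> where "is_perm (N n) \<sigma>" "superpattern (S321 n) \<sigma>"
      using superpattern_S321[of k n "N n"] by auto
    then show ?thesis by (auto simp: f_def)
  qed
  ultimately show ?thesis by blast
qed

end
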